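(* Let $\Omega$ be a set of nonzero $n$-tuples over $\{0,1\}$ such that $r(\Omega)=n$, such that either $s(\beta)$ is even for all $\beta\in\Omega$ or $s(\beta)$ is odd for all $\beta\in\Omega$, and such that $\sum_{\beta\in\Omega^{*}}\beta\neq\mathbf{0}$ in $\mathbb{Z}_{2}^{n}$, where $k=\min_{\beta\in\Omega}s(\beta)$ and $\Omega^{*}=\{\beta\in\Omega: s(\beta)=k\}$. Let $G$ be a graph and $r\in\mathbb{R}$ such that $\lambda/r$ is an odd integer for every eigenvalue $\lambda$ of the adjacency matrix of $G$. Then the Kronecker product $NEPS(P_{3},\ldots,P_{3};\Omega)\times G$ admits perfect state transfer at time $\tau_{k}/r$, where $\tau_{k}=\pi/(\sqrt{2})^{k}$.
   Context: $P_{3}$ is the path with vertices $1,2,3$ where $1$ and $3$ are adjacent to $2$. For a set $\Omega$ of nonzero $n$-tuples $\beta\in\{0,1\}^{n}$, $NEPS(P_{3},\ldots,P_{3};\Omega)$ ($n$ factors) has vertex set $\{1,2,3\}^{n}$, and $(x_{i})$, $(y_{i})$ are adjacent iff for some $\beta\in\Omega$, $x_{i}=y_{i}$ whenever $\beta_{i}=0$ and $x_{i}$ is adjacent to $y_{i}$ in $P_{3}$ whenever $\beta_{i}=1$. $r(\Omega)$ is the rank over $\mathbb{Z}_{2}$ of the matrix whose rows are the elements of $\Omega$; $s(\beta)$ is the number of nonzero entries of $\beta$. The Kronecker product $G_{1}\times G_{2}$ has vertex set $V(G_{1})\times V(G_{2})$, with $(u_{1},v_{1})\sim(u_{2},v_{2})$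 iff $u_{1}\sim u_{2}$ in $G_{1}$ and $v_{1}\sim v_{2}$ in $G_{2}$. For a graph with adjacency matrix $A$, perfect state transfer from $u$ to $v$ at time $\tau$ means $|e_{u}^{T}\exp(-i\tau A)e_{v}|=1$ (here between some pair of distinct vertices). *)

theory Defs
  imports "HOL-Analysis.Analysis" "HOL-Library.Z2"
begin

text \<open>
  A finite graph with nonempty vertex set is given by its adjacency relation on a finite type
  of vertices.
\<close>

definition simple_graph :: "('v::finite \<Rightarrow> 'v \<Rightarrow> bool) \<Rightarrow> bool" where
  "simple_graph E \<longleftrightarrow> symp E \<and> irreflp E"

definition adj_matrix :: "('v::finite \<Rightarrow> 'v \<Rightarrow> bool) \<Rightarrow> 'a::zero_neq_one ^ 'v ^ 'v" where
  "adj_matrix E = (\<chi> u v. if E u v then 1 else 0)"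

definition is_eigenvalue :: "'a::field ^ 'v ^ 'v \<Rightarrow> 'a \<Rightarrow> bool" where
  "is_eigenvalue A l \<longleftrightarrow> (\<exists>x. x \<noteq> 0 \<and> A *v x = l *s x)"

datatype p3_vertex = V1 | V2 | V3

instance p3_vertex :: finite
proof
  have "(UNIV :: p3_vertex set) \<subseteq> {V1, V2, V3}"
    using p3_vertex.exhaust by auto
  then show "finite (UNIV :: p3_vertex set)"
    by (rule finite_subset) simp
qed

definition P3 :: "p3_vertex \<Rightarrow> p3_vertex \<Rightarrow> bool" where
  "P3 u v \<longleftrightarrow> {u, v} = {V1, V2} \<or> {u, v} = {V2, V3}"

text \<open>
  The tuples in \<open>{0,1}\<close> are vectors over the two-element field \<^typ>\<open>bit\<close>, so that
  sums and dimensions of sets of tuples are taken over the integers modulo 2.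
\<close>

instance bit :: finite
proof
  have "(UNIV :: bit set) \<subseteq> {0, 1}"
    using bit_not_one_iff by auto
  then show "finite (UNIV :: bit set)"
    by (rule finite_subset) simp
qed

definition neps :: "('n::finite \<Rightarrow> 'v \<Rightarrow> 'v \<Rightarrow> bool) \<Rightarrow> (bit ^ 'n) set
    \<Rightarrow> 'v ^ 'n \<Rightarrow> 'v ^ 'n \<Rightarrow> bool" where
  "neps E \<Omega> x y \<longleftrightarrow>
    (\<exists>\<beta>\<in>\<Omega>. \<forall>i. (\<beta> $ i = 0 \<longrightarrow> x $ i = y $ i) \<and> (\<beta> $ i = 1 \<longrightarrow> E i (x $ i) (y $ i)))"

definition kronecker :: "('u \<Rightarrow> 'u \<Rightarrow> bool) \<Rightarrow> ('v \<Rightarrow> 'v \<Rightarrow> bool)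
    \<Rightarrow> 'u \<times> 'v \<Rightarrow> 'u \<times> 'v \<Rightarrow> bool" where
  "kronecker E F p q \<longleftrightarrow> E (fst p) (fst q) \<and> F (snd p) (snd q)"

text \<open>
  The rank of the matrix whose set of rows is \<open>\<Omega>\<close>, as in the library definition
  \<open>rank A = vec.dim (rows A)\<close>.
\<close>

definition tuple_rank :: "(bit ^ 'n::finite) set \<Rightarrow> nat" where
  "tuple_rank \<Omega> = vec.dim \<Omega>"

definition weight :: "bit ^ 'n::finite \<Rightarrow> nat" where
  "weight \<beta> = card {i. \<beta> $ i \<noteq> 0}"

definition min_weight :: "(bit ^ 'n::finite) set \<Rightarrow> nat" where
  "min_weight \<Omega> = Min (weight ` \<Omega>)"

definition min_weight_tuples :: "(bit ^ 'n::finite) set \<Rightarrow> (bit ^ 'n) set" where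
  "min_weight_tuples \<Omega> = {\<beta>\<in>\<Omega>. weight \<beta> = min_weight \<Omega>}"

text \<open>
  The multiplication of the type class on \<^typ>\<open>'a ^ 'v ^ 'v\<close> is componentwise, and
  so are its powers; powers of matrices have to be iterated from \<open>(**)\<close>.
\<close>

definition mat_exp :: "complex ^ 'v ^ 'v \<Rightarrow> complex ^ 'v ^ 'v" where
  "mat_exp A = (\<Sum>k. (1 / fact k) *\<^sub>R (((**) A ^^ k) (mat 1)))"

definition perfect_state_transfer ::
    "('v::finite \<Rightarrow> 'v \<Rightarrow> bool) \<Rightarrow> 'v \<Rightarrow> 'v \<Rightarrow> real \<Rightarrow> bool" where
  "perfect_state_transfer E u v \<tau> \<longleftrightarrow>
    cmod (scalar_product (axis u 1)
      (mat_exp (map_matrix (\<lambda>a. - \<i> * of_real \<tau> * a) (adj_matrix E)) *v axis v 1)) = 1"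

definition admits_pst :: "('v::finite \<Rightarrow> 'v \<Rightarrow> bool) \<Rightarrow> real \<Rightarrow> bool" where
  "admits_pst E \<tau> \<longleftrightarrow> (\<exists>u v. u \<noteq> v \<and> perfect_state_transfer E u v \<tau>)"

end

theory Submission
  imports Defs
begin

text \<open>
  The products over \<open>i\<close> of eigenvectors of \<open>P3\<close> for \<open>\<epsilon> i * sqrt 2\<close>, with
  \<open>\<epsilon> i \<in> {-1, 0, 1}\<close>, are eigenvectors of the NEPS. Since all weights have the same parity, the
  eigenvalue is \<open>sqrt 2 ^ k\<close> times an integer, whose parity is that of the number of minimal weight
  tuples supported where \<open>\<epsilon>\<close> is nonzero. The eigenvalues of \<open>G\<close> being odd multiples of \<open>r\<close>,
  the evolution at the given time multiplies such a vector, tensored with any vector on \<open>G\<close>, by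
  \<open>1\<close> or \<open>-1\<close> according to this parity. Choose a coordinate \<open>i\<close> that lies in the support of
  an odd number of minimal weight tuples. The vertices \<open>u\<close> and \<open>v\<close> that are \<open>V1\<close> and
  \<open>V3\<close> at \<open>i\<close>, and \<open>V2\<close> elsewhere, involve only \<open>\<epsilon>\<close> that are nonzero off \<open>i\<close>, and
  their components differ by the sign \<open>-1\<close> exactly when \<open>\<epsilon> i = 0\<close>, which is when the
  parity flips; so \<open>u\<close> is sent to \<open>v\<close> up to a global sign.
\<close>

section \<open>Eigenvectors of real symmetric matrices\<close>

lemma symmetric_dot:
  fixes A :: "real ^ 'n::finite ^ 'n"
  assumes "transpose A = A"
  shows "x \<bullet> (A *v y) = (A *v x) \<bullet> y"
  using transpose_matrix_vector[of A x] assms by (simp add: dot_lmul_matrix[symmetric])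

lemma span_eigenvectors_symmetric:
  fixes A :: "real ^ 'n::finite ^ 'n"
  assumes sym: "transpose A = A"
  shows "span {x. \<exists>l. A *v x = l *s x} = UNIV"
  \<comment> \<open>A maximizer of the quadratic form on the unit sphere of the orthogonal complement of the
    span is an eigenvector.\<close>
proof (rule ccontr)
  let ?E = "{x. \<exists>l. A *v x = l *s x}"
  define T where "T = {x. \<forall>y\<in>span ?E. y \<bullet> x = 0}"
  assume "span ?E \<noteq> UNIV"
  then have "dim ?E < DIM(real ^ 'n)"
    using dim_eq_full[of ?E] dim_subset_UNIV[of ?E] by linarith
  then obtain x0 where "x0 \<noteq> 0" "\<And>y. y \<in> span ?E \<Longrightarrow> orthogonal x0 y"
    by (rule orthogonal_to_subspace_exists) blast
  then have x0: "x0 \<noteq> 0" "\<forall>y\<in>span ?E. y \<bullet> x0 = 0"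
    by (auto simp: orthogonal_def inner_commute)
  have subT: "subspace T"
    unfolding T_def subspace_def by (auto simp: inner_add_right)
  have A_span: "A *v y \<in> span ?E" if "y \<in> span ?E" for y
    using that
  proof (induction rule: span_induct_alt)
    case base
    then show ?case by (simp add: span_zero)
  next
    case (step c x y)
    then obtain l where l: "A *v x = l *s x" by blast
    have "A *v (c *\<^sub>R x + y) = (c * l) *\<^sub>R x + A *v y"
      by (simp add: matrix_vector_right_distrib matrix_vector_mult_scaleR l scalar_mult_eq_scaleR)
    then show ?case using step by (simp add: span_add span_mul span_base)
  qed
  \<comment> \<open>By symmetry, the orthogonal complement of an invariant subspace is
    invariant.\<close>
  have AT: "A *v x \<in> T" if "x \<in> T" for x
    using that A_span unfolding T_def by (simp add: symmetric_dot[OF sym])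
  define K where "K = T \<inter> sphere 0 1"
  have "compact K"
    unfolding K_def by (intro closed_Int_compact closed_subspace subT compact_sphere)
  moreover have "(1 / norm x0) *\<^sub>R x0 \<in> K"
    using x0 unfolding K_def T_def by simp
  moreover have "continuous_on K (\<lambda>x. x \<bullet> (A *v x))"
    by (intro continuous_intros matrix_vector_mult_linear_continuous_on)
  ultimately obtain z where z: "z \<in> K" "\<And>y. y \<in> K \<Longrightarrow> y \<bullet> (A *v y) \<le> z \<bullet> (A *v z)"
    using continuous_attains_sup[of K "\<lambda>x. x \<bullet> (A *v x)"] by blast
  define l where "l = z \<bullet> (A *v z)"
  \<comment> \<open>On \<open>T\<close> this form is nonnegative and it vanishes at
    \<open>z\<close>, by the choice of \<open>z\<close>. Half its gradient at \<open>z\<close> is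
    the vector \<open>w\<close> below, so \<open>w\<close> has to vanish.\<close>
  define q where "q y = l * (y \<bullet> y) - y \<bullet> (A *v y)" for y
  have zT: "z \<in> T" and zz: "z \<bullet> z = 1"
    using z(1) by (auto simp: K_def dot_square_norm)
  have q_nonneg: "0 \<le> q y" if "y \<in> T" for y
  proof (cases "y = 0")
    case False
    then have "(1 / norm y) *\<^sub>R y \<in> K"
      using that subT by (simp add: K_def subspace_scale)
    from z(2)[OF this] have "(y \<bullet> (A *v y)) / (norm y)\<^sup>2 \<le> l"
      by (simp add: l_def matrix_vector_mult_scaleR power2_eq_square)
    then show ?thesis
      using False by (simp add: q_def field_simps dot_square_norm)
  qed (simp add: q_def)
  define w where "w = l *\<^sub>R z - A *v z"
  have wT: "w \<in> T"
    unfolding w_def using zT AT subT by (simp add: subspace_diff subspace_scale)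
  have expand: "q (z + t *\<^sub>R w) = 2 * t * (w \<bullet> w) + t\<^sup>2 * q w" for t
  proof -
    have wAz: "w \<bullet> (A *v z) = l * (w \<bullet> z) - w \<bullet> w"
      by (subst (4) w_def) (simp add: inner_diff_right)
    moreover have "z \<bullet> (A *v w) = l * (w \<bullet> z) - w \<bullet> w"
      using wAz by (metis symmetric_dot[OF sym] inner_commute)
    moreover have "l * (z \<bullet> z) = z \<bullet> (A *v z)"
      by (simp add: zz l_def)
    moreover have "q (z + t *\<^sub>R w) = l * (z \<bullet> z) - z \<bullet> (A *v z)
        + t * (2 * l * (w \<bullet> z) - w \<bullet> (A *v z) - z \<bullet> (A *v w)) + t\<^sup>2 * q w"
      unfolding q_def
      by (simp add: matrix_vector_right_distrib matrix_vector_mult_scaleR inner_add_left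
          inner_add_right inner_commute[of z w] power2_eq_square algebra_simps)
    ultimately show ?thesis
      by simp
  qed
  have "w \<bullet> w = 0"
  proof (rule ccontr)
    assume "w \<bullet> w \<noteq> 0"
    then have b: "0 < w \<bullet> w" by simp
    \<comment> \<open>A small step against the gradient makes \<open>q\<close> negative. The
      \<open>+ 1\<close> keeps the denominator positive and makes \<open>t * q w\<close> at least
      \<open>- (w \<bullet> w)\<close>, so that the linear term dominates.\<close>
    define t where "t = - (w \<bullet> w) / (q w + 1)"
    have qw: "0 \<le> q w" using q_nonneg[OF wT] .
    have "z + t *\<^sub>R w \<in> T"
      using zT wT subT by (simp add: subspace_add subspace_scale)
    from q_nonneg[OF this] have "0 \<le> t * (2 * (w \<bullet> w) + t * q w)"
      using expand[of t] by (simp add: power2_eq_square algebra_simps)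
    moreover have "t < 0" using b qw by (simp add: t_def)
    moreover have "0 < 2 * (w \<bullet> w) + t * q w"
    proof -
      have "t * q w = - ((w \<bullet> w) * (q w / (q w + 1)))"
        by (simp add: t_def)
      moreover have "(w \<bullet> w) * (q w / (q w + 1)) \<le> (w \<bullet> w) * 1"
        using b qw by (intro mult_left_mono) auto
      ultimately show ?thesis using b by linarith
    qed
    ultimately show False
      using mult_neg_pos[of t "2 * (w \<bullet> w) + t * q w"] by linarith
  qed
  then have "A *v z = l *s z"
    by (simp add: w_def scalar_mult_eq_scaleR)
  then have "z \<in> span ?E"
    by (intro span_base) blast
  then show False
    using zT zz by (auto simp: T_def)
qed

section \<open>The matrix exponential on eigenvectors\<close>

text \<open>Matrix multiplication is bilinear in finite dimension, hence bounded by some constant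
  \<open>K\<close>. Powers then grow at most geometrically, and the real exponential series
  dominates.\<close>

lemma summable_mat_exp:
  fixes A :: "complex ^ 'v::finite ^ 'v"
  shows "summable (\<lambda>k. (1 / fact k) *\<^sub>R (((**) A ^^ k) (mat 1)))"
proof -
  have bil: "bilinear ((**) :: complex ^ 'v ^ 'v \<Rightarrow> complex ^ 'v ^ 'v \<Rightarrow> complex ^ 'v ^ 'v)"
    unfolding bilinear_def
    by (auto intro!: linearI simp: vec_eq_iff matrix_matrix_mult_def sum.distrib scaleR_sum_right
        distrib_left distrib_right)
  obtain K where K: "norm (B ** C) \<le> norm B * norm C * K" for B C :: "complex ^ 'v ^ 'v"
    using bounded_bilinear.bounded[OF bil[unfolded bilinear_conv_bounded_bilinear]] by auto
  \<comment> \<open>The sign of \<open>K\<close> itself is unknown. Nonnegativity of this product is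
    what the induction on \<open>k\<close> needs for monotonicity.\<close>
  have K0: "0 \<le> norm A * K"
  proof (cases "A = 0")
    case False
    have "0 \<le> (norm A * norm A) * K" using K[of A A] norm_ge_zero order_trans by blast
    moreover have "0 < norm A * norm A" using False by simp
    ultimately show ?thesis by (simp add: zero_le_mult_iff)
  qed simp
  have bound: "norm (((**) A ^^ k) (mat 1)) \<le> (norm A * K) ^ k * norm (mat 1 :: complex ^ 'v ^ 'v)"
    for k
  proof (induction k)
    case (Suc k)
    have "norm (((**) A ^^ Suc k) (mat 1)) \<le> (norm A * K) * norm (((**) A ^^ k) (mat 1))"
      using K[of A "((**) A ^^ k) (mat 1)"] by (simp add: mult_ac)
    also have "\<dots> \<le> (norm A * K) * ((norm A * K) ^ k * norm (mat 1 :: complex ^ 'v ^ 'v))"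
      using Suc K0 by (rule mult_left_mono)
    finally show ?case by (simp add: mult_ac)
  qed simp
  have "summable (\<lambda>k. inverse (fact k) * (norm A * K) ^ k * norm (mat 1 :: complex ^ 'v ^ 'v))"
    by (intro summable_mult2 summable_exp)
  then show ?thesis
  proof (rule summable_comparison_test[rotated], intro exI allI impI)
    fix k
    show "norm ((1 / fact k) *\<^sub>R (((**) A ^^ k) (mat 1)))
      \<le> inverse (fact k) * (norm A * K) ^ k * norm (mat 1 :: complex ^ 'v ^ 'v)"
      using mult_left_mono[OF bound[of k], of "inverse (fact k)"]
      by (simp add: divide_inverse mult_ac)
  qed
qed

text \<open>Powers of \<open>A\<close> act on \<open>x\<close> as powers of \<open>l\<close>. Since
  both \<open>B \<mapsto> B *v x\<close> and \<open>c \<mapsto> c *s x\<close> are bounded linear,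
  the two exponential series can be compared term by term.\<close>

lemma mat_exp_eigenvector:
  fixes A :: "complex ^ 'v::finite ^ 'v"
  assumes "A *v x = l *s x"
  shows "mat_exp A *v x = exp l *s x"
proof -
  have pow: "((**) A ^^ k) (mat 1) *v x = l ^ k *s x" for k
  proof (induction k)
    case (Suc k)
    then show ?case
      using assms
      by (simp add: matrix_vector_mul_assoc[symmetric] vector_scalar_commute mult_ac)
  qed simp
  have "linear (\<lambda>B :: complex ^ 'v ^ 'v. B *v x)"
    by (auto intro!: linearI simp: vec_eq_iff matrix_vector_mult_def sum.distrib scaleR_sum_right
        distrib_right)
  then have bl: "bounded_linear (\<lambda>B :: complex ^ 'v ^ 'v. B *v x)"
    by (simp add: linear_conv_bounded_linear)
  have "linear (\<lambda>c :: complex. c *s x)"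
    by (auto intro!: linearI simp: vec_eq_iff distrib_right)
  then have bl': "bounded_linear (\<lambda>c :: complex. c *s x)"
    by (simp add: linear_conv_bounded_linear)
  have "(\<lambda>k. ((1 / fact k) *\<^sub>R (((**) A ^^ k) (mat 1))) *v x) sums (mat_exp A *v x)"
    unfolding mat_exp_def
    by (intro bounded_linear.sums[OF bl] summable_sums summable_mat_exp)
  moreover have "(\<lambda>k. (l ^ k /\<^sub>R fact k) *s x) sums (exp l *s x)"
    by (intro bounded_linear.sums[OF bl'] exp_converges)
  moreover have "((1 / fact k) *\<^sub>R (((**) A ^^ k) (mat 1))) *v x = (l ^ k /\<^sub>R fact k) *s x" for k
    using linear_cmul[OF bounded_linear.linear[OF bl], of "1 / fact k" "((**) A ^^ k) (mat 1)"] 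
    by (simp add: pow vec_eq_iff divide_inverse)
  ultimately show ?thesis
    by (metis (no_types, lifting) sums_cong sums_unique2)
qed

section \<open>Eigenvectors of NEPS and Kronecker products\<close>

lemma sum_prod_vec:
  fixes g :: "'n::finite \<Rightarrow> 'a::finite \<Rightarrow> 'b::comm_semiring_1"
  shows "(\<Sum>y\<in>(UNIV :: ('a ^ 'n) set). \<Prod>i\<in>UNIV. g i (y $ i)) = (\<Prod>i\<in>UNIV. \<Sum>a\<in>UNIV. g i a)"
proof -
  have "(\<Prod>i\<in>UNIV. \<Sum>a\<in>UNIV. g i a) = (\<Sum>f\<in>(UNIV :: ('n \<Rightarrow> 'a) set). \<Prod>i\<in>UNIV. g i (f i))"
    by (subst prod_sum_PiE) auto
  also have "\<dots> = (\<Sum>y\<in>(UNIV :: ('a ^ 'n) set). \<Prod>i\<in>UNIV. g i (y $ i))"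
    by (rule sum.reindex_bij_witness[of _ vec_nth vec_lambda]) auto
  finally show ?thesis by simp
qed

text \<open>Irreflexivity forces a tuple witnessing adjacency to be the indicator of the coordinates
  where \<open>x\<close> and \<open>y\<close> differ. At most one tuple qualifies, so the
  disjunction over \<Omega> is a sum without overcounting: the adjacency matrix is a sum of
  Kronecker products of identity and adjacency matrices.\<close>

lemma neps_entry:
  fixes \<Omega> :: "(bit ^ 'n::finite) set"
  assumes "\<And>i. irreflp (E i)"
  shows "(if neps E \<Omega> x y then 1 else 0 :: 'a::comm_semiring_1) =
    (\<Sum>\<beta>\<in>\<Omega>. \<Prod>i\<in>UNIV. if \<beta> $ i = 0 then of_bool (x $ i = y $ i) else of_bool (E i (x $ i) (y $ i)))"
proof -
  define P where "P \<beta> \<longleftrightarrow> (\<forall>i. if \<beta> $ i = 0 then x $ i = y $ i else E i (x $ i) (y $ i))"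
    for \<beta> :: "bit ^ 'n"
  have uniq: "\<beta> = \<gamma>" if "P \<beta>" "P \<gamma>" for \<beta> \<gamma>
  proof -
    have "\<beta> $ i = \<gamma> $ i" for i
      using that assms[of i] unfolding P_def irreflp_def
      by (metis (full_types) bit_not_zero_iff)
    then show ?thesis by (simp add: vec_eq_iff)
  qed
  have entry: "(\<Prod>i\<in>UNIV. if \<beta> $ i = 0 then of_bool (x $ i = y $ i)
      else of_bool (E i (x $ i) (y $ i)) :: 'a) = of_bool (P \<beta>)" for \<beta> :: "bit ^ 'n"
  proof (cases "P \<beta>")
    case True
    then show ?thesis unfolding P_def by (intro trans[OF prod.neutral]) (auto split: if_splits)
  next
    case False
    then obtain i where "\<not> (if \<beta> $ i = 0 then x $ i = y $ i else E i (x $ i) (y $ i))"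
      unfolding P_def by blast
    then show ?thesis
      using False by (intro trans[OF prod_zero]) (auto split: if_splits intro!: exI[of _ i])
  qed
  have neps: "neps E \<Omega> x y \<longleftrightarrow> (\<exists>\<beta>\<in>\<Omega>. P \<beta>)"
    unfolding neps_def P_def by (auto simp flip: bit_not_zero_iff)
  show ?thesis
  proof (cases "\<exists>\<beta>\<in>\<Omega>. P \<beta>")
    case True
    then obtain \<beta> where "\<beta> \<in> \<Omega>" "P \<beta>" by blast
    then have "{\<gamma>\<in>\<Omega>. P \<gamma>} = {\<beta>}" using uniq by blast
    then show ?thesis using True by (simp add: entry neps of_bool_def sum.If_cases Int_def)
  next
    case False
    then show ?thesis by (auto simp: entry neps)
  qed
qed

text \<open>Each summand of \<open>neps_entry\<close> acts on a product vector one coordinate at a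
  time, because the sum over all \<open>y\<close> factors by \<open>sum_prod_vec\<close>.\<close>

lemma neps_eigenvector:
  fixes \<Omega> :: "(bit ^ 'n::finite) set" and f :: "'n \<Rightarrow> 'v::finite \<Rightarrow> 'a::{comm_ring_1}"
  assumes irr: "\<And>i. irreflp (E i)"
    and eig: "\<And>i a. (\<Sum>b\<in>UNIV. of_bool (E i a b) * f i b) = l i * f i a"
  shows "(adj_matrix (neps E \<Omega>) :: 'a ^ ('v ^ 'n) ^ ('v ^ 'n)) *v (\<chi> x. \<Prod>i\<in>UNIV. f i (x $ i)) =
    (\<Sum>\<beta>\<in>\<Omega>. \<Prod>i\<in>UNIV. if \<beta> $ i = 0 then 1 else l i) *s (\<chi> x. \<Prod>i\<in>UNIV. f i (x $ i))"
proof -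
  let ?m = "\<lambda>(\<beta> :: bit ^ 'n) i a b. if \<beta> $ i = 0 then of_bool (a = b) else of_bool (E i a b) :: 'a"
  have loc: "(\<Sum>b\<in>UNIV. ?m \<beta> i a b * f i b) = (if \<beta> $ i = 0 then 1 else l i) * f i a" for \<beta> i a
    using eig[of i a] by (simp add: of_bool_def if_distrib[of "\<lambda>c. c * _"] cong: if_cong)
  have "(\<Sum>y\<in>UNIV. (if neps E \<Omega> x y then 1 else 0) * (\<Prod>i\<in>UNIV. f i (y $ i))) =
      (\<Sum>\<beta>\<in>\<Omega>. \<Prod>i\<in>UNIV. if \<beta> $ i = 0 then 1 else l i) * (\<Prod>i\<in>UNIV. f i (x $ i))" for x
  proof -
    have "(\<Sum>y\<in>UNIV. (if neps E \<Omega> x y then 1 else 0) * (\<Prod>i\<in>UNIV. f i (y $ i))) =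
      (\<Sum>y\<in>UNIV. \<Sum>\<beta>\<in>\<Omega>. \<Prod>i\<in>UNIV. ?m \<beta> i (x $ i) (y $ i) * f i (y $ i))"
      by (simp only: neps_entry[OF irr] sum_distrib_right prod.distrib)
    also have "\<dots> = (\<Sum>\<beta>\<in>\<Omega>. \<Sum>y\<in>UNIV. \<Prod>i\<in>UNIV. ?m \<beta> i (x $ i) (y $ i) * f i (y $ i))"
      by (rule sum.swap)
    also have "\<dots> = (\<Sum>\<beta>\<in>\<Omega>. \<Prod>i\<in>UNIV. \<Sum>b\<in>UNIV. ?m \<beta> i (x $ i) b * f i b)"
      by (intro sum.cong refl sum_prod_vec)
    also have "\<dots> = (\<Sum>\<beta>\<in>\<Omega>. \<Prod>i\<in>UNIV. if \<beta> $ i = 0 then 1 else l i) * (\<Prod>i\<in>UNIV. f i (x $ i))"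
      by (simp only: loc prod.distrib sum_distrib_right)
    finally show ?thesis .
  qed
  then show ?thesis
    by (simp add: vec_eq_iff matrix_vector_mult_def adj_matrix_def)
qed

definition tensor :: "'a::times ^ 'u \<Rightarrow> 'a ^ 'v \<Rightarrow> 'a ^ ('u \<times> 'v)" where
  "tensor x y = (\<chi> p. x $ fst p * y $ snd p)"

lemma kronecker_eigenvector:
  fixes x :: "'a::comm_ring_1 ^ 'u::finite" and y :: "'a ^ 'v::finite"
  assumes "adj_matrix E *v x = l *s x" and "adj_matrix F *v y = m *s y"
  shows "adj_matrix (kronecker E F) *v tensor x y = (l * m) *s tensor x y"
proof -
  have "(\<Sum>q\<in>UNIV. (if kronecker E F p q then 1 else 0) * (x $ fst q * y $ snd q)) =
      l * m * (x $ fst p * y $ snd p)" for p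
  proof -
    have "(\<Sum>q\<in>UNIV. (if kronecker E F p q then 1 else 0) * (x $ fst q * y $ snd q)) =
      (\<Sum>q\<in>UNIV \<times> UNIV. ((if E (fst p) (fst q) then 1 else 0) * x $ fst q)
        * ((if F (snd p) (snd q) then 1 else 0) * y $ snd q))"
      by (intro sum.cong) (auto simp: kronecker_def)
    also have "\<dots> = (\<Sum>a\<in>UNIV. (if E (fst p) a then 1 else 0) * x $ a)
        * (\<Sum>b\<in>UNIV. (if F (snd p) b then 1 else 0) * y $ b)"
      by (simp add: sum_product sum.cartesian_product case_prod_beta)
    also have "\<dots> = (adj_matrix E *v x) $ fst p * (adj_matrix F *v y) $ snd p"
      by (simp add: matrix_vector_mult_def adj_matrix_def)
    finally show ?thesis by (simp add: assms mult_ac)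
  qed
  then show ?thesis
    by (simp add: vec_eq_iff matrix_vector_mult_def adj_matrix_def tensor_def)
qed

section \<open>Evolution on a Kronecker product with odd spectrum\<close>

text \<open>Eigenvectors are found over the reals, whereas the evolution is a complex matrix; this
  embedding connects the two.\<close>

definition of_real_vec :: "real ^ 'n \<Rightarrow> complex ^ 'n" where
  "of_real_vec x = (\<chi> i. of_real (x $ i))"

lemma mat_exp_adj_eigenvector:
  fixes E :: "'v::finite \<Rightarrow> 'v \<Rightarrow> bool"
  assumes "adj_matrix E *v x = l *s x"
  shows "mat_exp (map_matrix (\<lambda>a. c * a) (adj_matrix E)) *v of_real_vec x =
    exp (c * of_real l) *s of_real_vec x"
proof (rule mat_exp_eigenvector)
  have "(\<Sum>j\<in>UNIV. c * (if E i j then 1 else 0) * of_real (x $ j)) = c * of_real (l * x $ i)" for i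
  proof -
    have "(\<Sum>j\<in>UNIV. c * (if E i j then 1 else 0) * of_real (x $ j)) =
      c * of_real ((adj_matrix E *v x) $ i)"
      by (auto simp: matrix_vector_mult_def adj_matrix_def sum_distrib_left intro!: sum.cong)
    then show ?thesis by (simp add: assms)
  qed
  then show "map_matrix (\<lambda>a. c * a) (adj_matrix E) *v of_real_vec x =
    (c * of_real l) *s of_real_vec x"
    by (simp add: vec_eq_iff matrix_vector_mult_def adj_matrix_def of_real_vec_def map_matrix_def
        mult.assoc)
qed

lemma exp_neg_pi_int: "exp (- (\<i> * of_real pi * of_int n)) = (if even n then 1 else - 1)"
proof (cases "even n")
  case True
  then obtain j where "n = 2 * j" by blast
  then show ?thesis
    using exp_integer_2pi[of "- of_int j"] by (simp add: mult_ac)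
next
  case False
  then obtain j where "n = 2 * j + 1" by (elim oddE)
  \<comment> \<open>The witness comes from \<open>- (2 * j + 1) = 2 * (- j - 1) + 1\<close>.\<close>
  then have "- (\<i> * of_real pi * of_int n) = (2 * of_int (- j - 1) + 1) * of_real pi * \<i>"
    by (simp add: algebra_simps)
  then show ?thesis
    using exp_integer_2pi_plus1[of "of_int (- j - 1)"] False by simp
qed

text \<open>If \<open>y\<close> is an eigenvector of \<open>G\<close> for \<open>r * m\<close> with
  \<open>m\<close> odd, the phase is the exponential of \<open>- \<i> * pi * n * m\<close>, a sign
  given by the parity of \<open>n\<close> alone. Not depending on \<open>m\<close>, it extends
  linearly from the eigenvectors to every \<open>y\<close>.\<close>

lemma mat_exp_kronecker_odd:
  fixes E :: "'u::finite \<Rightarrow> 'u \<Rightarrow> bool" and G :: "'v::finite \<Rightarrow> 'v \<Rightarrow> bool"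
  assumes "simple_graph G" and "r \<noteq> 0"
    and odd_eig: "\<And>l::real. is_eigenvalue (adj_matrix G) l \<Longrightarrow> \<exists>m::int. odd m \<and> l / r = of_int m"
    and "s \<noteq> 0" and eig: "adj_matrix E *v x = (s * of_int n) *s x"
  shows "mat_exp (map_matrix (\<lambda>a. - \<i> * of_real (pi / s / r) * a) (adj_matrix (kronecker E G)))
      *v of_real_vec (tensor x y) = (if even n then 1 else - 1) *s of_real_vec (tensor x y)"
    (is "?U *v _ = ?\<sigma> *s _")
proof -
  have "transpose (adj_matrix G) = (adj_matrix G :: real ^ 'v ^ 'v)"
    using \<open>simple_graph G\<close>
    by (auto simp: simple_graph_def transpose_def adj_matrix_def vec_eq_iff symp_def)
  then have "y \<in> span {y. \<exists>l. (adj_matrix G :: real ^ 'v ^ 'v) *v y = l *s y}"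
    using span_eigenvectors_symmetric by blast
  then show ?thesis
  proof (induction rule: span_induct_alt)
    case base
    show ?case
      by (simp add: tensor_def of_real_vec_def vec_eq_iff matrix_vector_mult_def)
  next
    case (step c y z)
    have y: "?U *v of_real_vec (tensor x y) = ?\<sigma> *s of_real_vec (tensor x y)"
    \<comment> \<open>The spanning set contains 0, for which \<open>l\<close> may be any number, not
      only an eigenvalue.\<close>
    proof (cases "y = 0")
      case True
      then show ?thesis
        by (simp add: tensor_def of_real_vec_def vec_eq_iff matrix_vector_mult_def)
    next
      case False
      obtain l where l: "(adj_matrix G :: real ^ 'v ^ 'v) *v y = l *s y" using step by blast
      with False obtain m where m: "odd m" "l / r = of_int m"
        using odd_eig[of l] unfolding is_eigenvalue_def by blast
      have "- \<i> * of_real (pi / s / r) * of_real (s * of_int n * l) =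
          - (\<i> * of_real pi * of_int (n * m))"
      proof -
        have "pi / s / r * (s * of_int n * l) = pi * of_int n * (l / r)"
          using \<open>s \<noteq> 0\<close> by simp
        then have "complex_of_real (pi / s / r * (s * of_int n * l)) =
            of_real (pi * of_int n * of_int m)"
          by (simp only: m)
        then show ?thesis
          by (simp only: of_real_mult of_real_of_int_eq of_int_mult mult.assoc mult_minus_left)
      qed
      then show ?thesis
        using mat_exp_adj_eigenvector[OF kronecker_eigenvector[OF eig l],
            of "- \<i> * of_real (pi / s / r)"] m(1)
        by (simp only: exp_neg_pi_int even_mult_iff simp_thms)
    qed
    have "of_real_vec (tensor x (c *\<^sub>R y + z)) =
        of_real c *s of_real_vec (tensor x y) + of_real_vec (tensor x z)"
      by (simp add: tensor_def of_real_vec_def vec_eq_iff algebra_simps)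
    then show ?case
      by (simp only: matrix_vector_right_distrib vector_scalar_commute y step(2)
          vector_add_ldistrib vector_smult_assoc mult.commute[of ?\<sigma>])
  qed
qed

section \<open>Eigenbasis of \<open>P3\<close> and its products\<close>

text \<open>The orthogonal eigenvectors (1, sqrt 2, 1), (1, - sqrt 2, 1) and (1, 0, -1), with
  squared norms 4, 4 and 2. The index is an integer so that parities of eigenvalues can be taken
  later.\<close>

definition p3_vec :: "int \<Rightarrow> p3_vertex \<Rightarrow> real" where
  "p3_vec e a = (case a of V1 \<Rightarrow> 1 | V2 \<Rightarrow> of_int e * sqrt 2 | V3 \<Rightarrow> if e = 0 then - 1 else 1)"

lemma UNIV_p3_vertex: "UNIV = {V1, V2, V3}"
  using p3_vertex.exhaust by auto

lemma irreflp_P3: "irreflp P3"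
  by (auto simp: irreflp_def P3_def doubleton_eq_iff)

lemma P3_eigenvector:
  assumes "e \<in> {- 1, 0, 1}"
  shows "(\<Sum>b\<in>UNIV. of_bool (P3 a b) * p3_vec e b) = of_int e * sqrt 2 * p3_vec e a"
  using assms
  by (cases a) (auto simp: UNIV_p3_vertex P3_def p3_vec_def doubleton_eq_iff)

text \<open>The completeness relation of the orthogonal eigenbasis; the denominators are the squared
  norms.\<close>

lemma p3_vec_expansion:
  "(\<Sum>e\<in>{- 1, 0, 1}. p3_vec e a / (if e = 0 then 2 else 4) * p3_vec e b) = of_bool (a = b)"
  by (cases a; cases b) (auto simp: p3_vec_def)

definition p3_prod_vec :: "('n \<Rightarrow> int) \<Rightarrow> real ^ (p3_vertex ^ 'n::finite)" where
  "p3_prod_vec \<epsilon> = (\<chi> x. \<Prod>i\<in>UNIV. p3_vec (\<epsilon> i) (x $ i))"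

text \<open>Coordinate of the unit vector at \<open>u\<close> along
  \<open>p3_prod_vec \<epsilon>\<close>: the inner product divided by the squared norm.\<close>

definition p3_coeff :: "p3_vertex ^ 'n \<Rightarrow> ('n::finite \<Rightarrow> int) \<Rightarrow> real" where
  "p3_coeff u \<epsilon> = (\<Prod>i\<in>UNIV. p3_vec (\<epsilon> i) (u $ i) / (if \<epsilon> i = 0 then 2 else 4))"

text \<open>This is the product of \<open>p3_vec_expansion\<close> over all coordinates, multiplied
  out. The domain being \<open>UNIV\<close>, the index set consists of all functions into the three
  values.\<close>

lemma axis_eq_sum_p3_prod_vec:
  "axis u 1 = (\<Sum>\<epsilon>\<in>UNIV \<rightarrow>\<^sub>E {- 1, 0, 1}. p3_coeff u \<epsilon> *s p3_prod_vec \<epsilon>)"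
proof -
  have "(\<Sum>\<epsilon>\<in>UNIV \<rightarrow>\<^sub>E {- 1, 0, 1}. p3_coeff u \<epsilon> * p3_prod_vec \<epsilon> $ x) = of_bool (u = x)" for x
  proof -
    have "(\<Sum>\<epsilon>\<in>UNIV \<rightarrow>\<^sub>E {- 1, 0, 1}. p3_coeff u \<epsilon> * p3_prod_vec \<epsilon> $ x) =
      (\<Prod>i\<in>UNIV. \<Sum>e\<in>{- 1, 0, 1}. p3_vec e (u $ i) / (if e = 0 then 2 else 4) * p3_vec e (x $ i))"
      by (subst prod_sum_PiE) (simp_all add: p3_coeff_def p3_prod_vec_def flip: prod.distrib)
    also have "\<dots> = (\<Prod>i\<in>UNIV. of_bool (u $ i = x $ i))"
      by (simp only: p3_vec_expansion)
    also have "\<dots> = of_bool (u = x)"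
    proof (cases "u = x")
      case False
      then obtain i where "u $ i \<noteq> x $ i" by (auto simp: vec_eq_iff)
      then show ?thesis using False by (intro trans[OF prod_zero]) auto
    qed simp
    finally show ?thesis .
  qed
  then show ?thesis
    by (subst vec_eq_iff) (simp add: axis_def)
qed

section \<open>Parity of the scaled eigenvalues\<close>

text \<open>The eigenvalue of \<open>p3_prod_vec\<close>, in units of \<open>sqrt 2 ^ min_weight \<Omega>\<close>.\<close>

definition scaled_eig :: "(bit ^ 'n::finite) set \<Rightarrow> ('n \<Rightarrow> int) \<Rightarrow> int" where
  "scaled_eig \<Omega> \<epsilon> = (\<Sum>\<beta>\<in>\<Omega>. 2 ^ ((weight \<beta> - min_weight \<Omega>) div 2)
      * (\<Prod>i\<in>UNIV. if \<beta> $ i = 0 then 1 else \<epsilon> i))"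

lemma min_weight_le:
  assumes "\<beta> \<in> \<Omega>"
  shows "min_weight \<Omega> \<le> weight \<beta>"
  using assms unfolding min_weight_def by (simp add: Min_le)

text \<open>The minimum is attained in \<Omega> and so has the common parity. Hence the halving in
  \<open>scaled_eig\<close> is exact.\<close>

lemma even_weight_diff:
  assumes "(\<forall>\<beta>\<in>\<Omega>. even (weight \<beta>)) \<or> (\<forall>\<beta>\<in>\<Omega>. odd (weight \<beta>))" and "\<beta> \<in> \<Omega>"
  shows "even (weight \<beta> - min_weight \<Omega>)"
proof -
  have "min_weight \<Omega> \<in> weight ` \<Omega>"
    using assms(2) unfolding min_weight_def by (intro Min_in) auto
  then show ?thesis using assms by auto
qed

lemma neps_P3_eigenvector:
  fixes \<Omega> :: "(bit ^ 'n::finite) set"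
  assumes par: "(\<forall>\<beta>\<in>\<Omega>. even (weight \<beta>)) \<or> (\<forall>\<beta>\<in>\<Omega>. odd (weight \<beta>))"
    and \<epsilon>: "\<And>i. \<epsilon> i \<in> {- 1, 0, 1}"
  shows "adj_matrix (neps (\<lambda>_. P3) \<Omega>) *v p3_prod_vec \<epsilon> =
    (sqrt 2 ^ min_weight \<Omega> * of_int (scaled_eig \<Omega> \<epsilon>)) *s p3_prod_vec \<epsilon>"
proof -
  have "(\<Prod>i\<in>UNIV. if \<beta> $ i = 0 then 1 else of_int (\<epsilon> i) * sqrt 2) =
    sqrt 2 ^ min_weight \<Omega> * (2 ^ ((weight \<beta> - min_weight \<Omega>) div 2)
      * (\<Prod>i\<in>UNIV. if \<beta> $ i = 0 then 1 else of_int (\<epsilon> i)))" if "\<beta> \<in> \<Omega>" for \<beta>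
  proof -
    have "(\<Prod>i\<in>UNIV. if \<beta> $ i = 0 then 1 else of_int (\<epsilon> i) * sqrt 2) =
      (\<Prod>i\<in>UNIV. (if \<beta> $ i \<noteq> 0 then sqrt 2 else 1) * (if \<beta> $ i = 0 then 1 else of_int (\<epsilon> i)))"
      by (intro prod.cong) auto
    \<comment> \<open>Every coordinate in the support of \<beta> contributes one factor
      \<open>sqrt 2\<close>.\<close>
    also have "\<dots> = sqrt 2 ^ weight \<beta> * (\<Prod>i\<in>UNIV. if \<beta> $ i = 0 then 1 else of_int (\<epsilon> i))"
      unfolding prod.distrib weight_def by (subst prod.If_cases) simp_all
    also have "sqrt 2 ^ weight \<beta> = sqrt 2 ^ (min_weight \<Omega> + 2 * ((weight \<beta> - min_weight \<Omega>) div 2))"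
      using even_weight_diff[OF par that] min_weight_le[OF that] by simp
    also have "\<dots> = sqrt 2 ^ min_weight \<Omega> * 2 ^ ((weight \<beta> - min_weight \<Omega>) div 2)"
      by (simp add: power_add power_mult)
    finally show ?thesis by (simp add: mult.assoc)
  qed
  then have "(\<Sum>\<beta>\<in>\<Omega>. \<Prod>i\<in>UNIV. if \<beta> $ i = 0 then 1 else of_int (\<epsilon> i) * sqrt 2) =
      sqrt 2 ^ min_weight \<Omega> * of_int (scaled_eig \<Omega> \<epsilon>)"
    by (simp add: scaled_eig_def sum_distrib_left if_distrib cong: if_cong)
  moreover have "adj_matrix (neps (\<lambda>_. P3) \<Omega>) *v p3_prod_vec \<epsilon> =
      (\<Sum>\<beta>\<in>\<Omega>. \<Prod>i\<in>UNIV. if \<beta> $ i = 0 then 1 else of_int (\<epsilon> i) * sqrt 2) *s p3_prod_vec \<epsilon>"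
    unfolding p3_prod_vec_def by (intro neps_eigenvector irreflp_P3 P3_eigenvector \<epsilon>)
  ultimately show ?thesis by simp
qed

text \<open>Modulo 2 the summands with a positive power of 2 drop out, which leaves the minimal
  weight tuples. Such a summand is odd exactly when \<epsilon> has no zero on the support of the
  tuple.\<close>

lemma even_scaled_eig_iff:
  fixes \<Omega> :: "(bit ^ 'n::finite) set"
  assumes par: "(\<forall>\<beta>\<in>\<Omega>. even (weight \<beta>)) \<or> (\<forall>\<beta>\<in>\<Omega>. odd (weight \<beta>))"
    and \<epsilon>: "\<And>i. \<epsilon> i \<in> {- 1, 0, 1}"
  shows "even (scaled_eig \<Omega> \<epsilon>) \<longleftrightarrow>
    even (card {\<beta>\<in>min_weight_tuples \<Omega>. \<forall>i. \<beta> $ i \<noteq> 0 \<longrightarrow> \<epsilon> i \<noteq> 0})"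
proof -
  have odd_prod: "odd (\<Prod>i\<in>UNIV. if \<beta> $ i = 0 then 1 else \<epsilon> i) \<longleftrightarrow> (\<forall>i. \<beta> $ i \<noteq> 0 \<longrightarrow> \<epsilon> i \<noteq> 0)"
    for \<beta> :: "bit ^ 'n"
  proof -
    have "odd (\<epsilon> i) \<longleftrightarrow> \<epsilon> i \<noteq> 0" for i using \<epsilon>[of i] by auto
    then show ?thesis by (auto simp: even_prod_iff)
  qed
  have "(weight \<beta> - min_weight \<Omega>) div 2 = 0 \<longleftrightarrow> weight \<beta> = min_weight \<Omega>" if "\<beta> \<in> \<Omega>" for \<beta>
    using even_weight_diff[OF par that] min_weight_le[OF that] by presburger
  then have "{\<beta>\<in>\<Omega>. odd (2 ^ ((weight \<beta> - min_weight \<Omega>) div 2)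
      * (\<Prod>i\<in>UNIV. if \<beta> $ i = 0 then 1 else \<epsilon> i))} =
    {\<beta>\<in>min_weight_tuples \<Omega>. \<forall>i. \<beta> $ i \<noteq> 0 \<longrightarrow> \<epsilon> i \<noteq> 0}"
    unfolding min_weight_tuples_def by (auto simp: odd_prod even_power)
  then show ?thesis
    unfolding scaled_eig_def by (subst even_sum_iff) simp_all
qed

section \<open>Transfer between the chosen vertices\<close>

lemma of_real_vec_tensor_sum:
  "of_real_vec (tensor (\<Sum>a\<in>S. c a *s x a) y) = (\<Sum>a\<in>S. of_real (c a) *s of_real_vec (tensor (x a) y))"
  by (simp add: vec_eq_iff of_real_vec_def tensor_def sum_distrib_right mult.assoc)

lemma of_real_vec_tensor_axis: "of_real_vec (tensor (axis u 1) (axis w 1)) = axis (u, w) 1"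
  by (auto simp: vec_eq_iff of_real_vec_def tensor_def axis_def)

text \<open>A coordinate of a sum over \<open>bit\<close> counts, modulo 2, the summands that are
  nonzero there.\<close>

lemma odd_card_of_sum_bit:
  fixes S :: "(bit ^ 'n::finite) set"
  assumes "(\<Sum>\<beta>\<in>S. \<beta>) $ i \<noteq> 0"
  shows "odd (card {\<beta>\<in>S. \<beta> $ i \<noteq> 0})"
proof -
  have bit_eq_of_bool: "b = of_bool (b \<noteq> 0)" for b :: bit
    by (cases "b = 0") simp_all
  have "(\<Sum>\<beta>\<in>S. \<beta>) $ i = (\<Sum>\<beta>\<in>S. of_bool (\<beta> $ i \<noteq> 0))"
    unfolding sum_component by (intro sum.cong refl bit_eq_of_bool)
  also have "\<dots> = of_nat (card {\<beta>\<in>S. \<beta> $ i \<noteq> 0})"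
    by (simp add: of_bool_def sum.If_cases Int_def)
  finally show ?thesis
    using assms by (auto elim!: evenE)
qed

theorem theorem5p1:
  fixes \<Omega> :: "(bit ^ 'n::finite) set"
    and G :: "'v::finite \<Rightarrow> 'v \<Rightarrow> bool"
    and r :: real
  assumes "0 \<notin> \<Omega>"
    and "tuple_rank \<Omega> = CARD('n)"
    and "(\<forall>\<beta>\<in>\<Omega>. even (weight \<beta>)) \<or> (\<forall>\<beta>\<in>\<Omega>. odd (weight \<beta>))"
    and "(\<Sum>\<beta>\<in>min_weight_tuples \<Omega>. \<beta>) \<noteq> 0"
    and "simple_graph G"
    and "r \<noteq> 0"
    and "\<And>l::real. is_eigenvalue (adj_matrix G) l \<Longrightarrow> \<exists>m::int. odd m \<and> l / r = of_int m"
  shows "admits_pst (kronecker (neps (\<lambda>_. P3) \<Omega>) G) (pi / (sqrt 2) ^ min_weight \<Omega> / r)"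
proof -
  let ?S = "min_weight_tuples \<Omega>" and ?I = "UNIV \<rightarrow>\<^sub>E {- 1, 0, 1 :: int}"
  let ?U = "mat_exp (map_matrix (\<lambda>a. - \<i> * of_real (pi / (sqrt 2) ^ min_weight \<Omega> / r) * a)
    (adj_matrix (kronecker (neps (\<lambda>_. P3) \<Omega>) G)))"
  obtain i where i: "(\<Sum>\<beta>\<in>?S. \<beta>) $ i \<noteq> 0"
    using assms(4) by (auto simp: vec_eq_iff)
  define u v :: "p3_vertex ^ 'n" where
    "u = (\<chi> j. if j = i then V1 else V2)" and "v = (\<chi> j. if j = i then V3 else V2)"
  have "u $ i \<noteq> v $ i" by (simp add: u_def v_def)
  then have uv: "u \<noteq> v" by metis
  \<comment> \<open>\<open>\<sigma> \<epsilon>\<close> is the sign that the evolution gives to the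
    component of \<epsilon>. \<open>p\<close> is its value when \<epsilon> has no zeros, and turns
    out to be the global sign.\<close>
  define \<sigma> :: "('n \<Rightarrow> int) \<Rightarrow> real" where "\<sigma> \<epsilon> = (if even (scaled_eig \<Omega> \<epsilon>) then 1 else - 1)" for \<epsilon>
  define p :: real where "p = (if even (card ?S) then 1 else - 1)"
  have coeff: "p3_coeff u \<epsilon> * \<sigma> \<epsilon> = p * p3_coeff v \<epsilon>" if "\<epsilon> \<in> ?I" for \<epsilon>
  proof (cases "\<exists>j. j \<noteq> i \<and> \<epsilon> j = 0")
    \<comment> \<open>At \<open>j\<close> both vertices are \<open>V2\<close>, where the kernel
      vector of \<open>P3\<close> vanishes.\<close>
    case True
    then obtain j where "j \<noteq> i" "\<epsilon> j = 0" by blast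
    then have "p3_coeff u \<epsilon> = 0" "p3_coeff v \<epsilon> = 0"
      unfolding p3_coeff_def by (auto simp: u_def v_def p3_vec_def intro!: bexI[of _ j])
    then show ?thesis by simp
  next
    case False
    have \<epsilon>: "\<epsilon> j \<in> {- 1, 0, 1}" for j using that by (auto simp: PiE_def Pi_def)
    have v: "p3_coeff v \<epsilon> = (if \<epsilon> i = 0 then - 1 else 1) * p3_coeff u \<epsilon>"
      unfolding p3_coeff_def
      by (simp add: prod.remove[of UNIV i] u_def v_def p3_vec_def)
    \<comment> \<open>If \<open>\<epsilon> i = 0\<close>, the tuples with a nonzero entry at
      \<open>i\<close> are discarded. Their number is odd, so the parity flips, which matches the
      opposite entries of the kernel vector at \<open>V1\<close> and \<open>V3\<close>.\<close>
    have "card ?S = card {\<beta>\<in>?S. \<beta> $ i = 0} + card {\<beta>\<in>?S. \<beta> $ i \<noteq> 0}"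
      by (subst card_Un_disjoint[symmetric]) (auto intro: arg_cong[of _ _ card])
    moreover note odd_card_of_sum_bit[OF i]
    moreover have "{\<beta>\<in>?S. \<forall>j. \<beta> $ j \<noteq> 0 \<longrightarrow> \<epsilon> j \<noteq> 0} = (if \<epsilon> i = 0 then {\<beta>\<in>?S. \<beta> $ i = 0} else ?S)"
      using False by (auto simp del: bit_not_zero_iff)
    ultimately have "even (scaled_eig \<Omega> \<epsilon>) \<longleftrightarrow> (even (card ?S) \<longleftrightarrow> \<epsilon> i \<noteq> 0)"
      unfolding even_scaled_eig_iff[OF assms(3) \<epsilon>] by auto
    then show ?thesis by (auto simp: v \<sigma>_def p_def)
  qed
  \<comment> \<open>Any vertex of \<open>G\<close> will do; the second component stays in
    place.\<close>
  fix w :: 'v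
  have "?U *v axis (u, w) 1 =
    (\<Sum>\<epsilon>\<in>?I. of_real (p3_coeff u \<epsilon>) *s (?U *v of_real_vec (tensor (p3_prod_vec \<epsilon>) (axis w 1))))"
    unfolding of_real_vec_tensor_axis[symmetric] axis_eq_sum_p3_prod_vec of_real_vec_tensor_sum
    by (simp add: vec.linear_sum[OF matrix_vector_mul_linear_gen] vector_scalar_commute)
  also have "\<dots> = (\<Sum>\<epsilon>\<in>?I. of_real (p3_coeff u \<epsilon>) *s
      (of_real (\<sigma> \<epsilon>) *s of_real_vec (tensor (p3_prod_vec \<epsilon>) (axis w 1))))"
  proof (intro sum.cong refl arg_cong2[where f = "(*s)"])
    fix \<epsilon> :: "'n \<Rightarrow> int"
    assume "\<epsilon> \<in> ?I"
    then have "\<And>j. \<epsilon> j \<in> {- 1, 0, 1}" by (auto simp: PiE_def Pi_def)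
    from mat_exp_kronecker_odd[OF assms(5,6,7) _ neps_P3_eigenvector[OF assms(3) this]]
    show "?U *v of_real_vec (tensor (p3_prod_vec \<epsilon>) (axis w 1)) =
        of_real (\<sigma> \<epsilon>) *s of_real_vec (tensor (p3_prod_vec \<epsilon>) (axis w 1))"
      by (simp add: \<sigma>_def)
  qed
  also have "\<dots> = (\<Sum>\<epsilon>\<in>?I. of_real p *s
      (of_real (p3_coeff v \<epsilon>) *s of_real_vec (tensor (p3_prod_vec \<epsilon>) (axis w 1))))"
    by (intro sum.cong refl) (simp add: vector_smult_assoc coeff flip: of_real_mult)
  also have "\<dots> = of_real p *s axis (v, w) 1"
    unfolding of_real_vec_tensor_axis[symmetric] axis_eq_sum_p3_prod_vec of_real_vec_tensor_sum
    by (simp add: vec.scale_sum_right)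
  finally have "scalar_product (axis (v, w) 1) (?U *v axis (u, w) 1) = of_real p"
    by (simp add: scalar_product_def axis_def if_distrib cong: if_cong)
  \<comment> \<open>The number computed is the entry in row \<open>(v, w)\<close> and column
    \<open>(u, w)\<close>, hence the order of the vertices. It is 1 or -1.\<close>
  then have "perfect_state_transfer (kronecker (neps (\<lambda>_. P3) \<Omega>) G) (v, w) (u, w)
      (pi / (sqrt 2) ^ min_weight \<Omega> / r)"
    unfolding perfect_state_transfer_def by (simp only: norm_of_real) (simp add: p_def)
  then show ?thesis
    unfolding admits_pst_def using uv by (intro exI[of _ "(v, w)"] exI[of _ "(u, w)"]) simp
qed

end
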